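(* Let $n \ge 1$ and $k \ge 3$ be integers, and let $$S := \left\langle \left\{ \frac{(n+i)\,(n + (i \bmod 2) + 1)}{2} : 0 \le i \le k \right\}\right\rangle,$$ where $i \bmod 2 \in \{0,1\}$ is the residue of $i$ modulo $2$. Then $S$ is a numerical semigroup, and with $T_m := \frac{m(m+1)}{2}$, $$F(S) = \begin{cases} \left\lceil \dfrac{n-2}{2\lfloor k/2\rfloor}\right\rceil T_n + \left\lceil \dfrac{n}{\lfloor (k-1)/2\rfloor}\right\rceil T_{n+1} + n^2 + n - 1, & \text{if } n \text{ is even},\\[8pt] \left\lceil \dfrac{n-1}{\lfloor k/2\rfloor}\right\rceil T_n + \left\lceil \dfrac{n-1}{2\lfloor (k-1)/2\rfloor}\right\rceil T_{n+1} + n^2 - 2, & \text{if } n \text{ is odd}.\end{cases}$$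
   Context: $\mathbb{N}$ denotes the nonnegative integers. For a set $A$ of positive integers, $\langle A\rangle$ is the submonoid of $(\mathbb{N},+)$ generated by $A$. A numerical semigroup is a submonoid $S\subseteq\mathbb{N}$ with $\mathbb{N}\setminus S$ finite; its Frobenius number $F(S)$ is the largest integer not in $S$ (with $F(\mathbb{N})=-1$). *)

theory Defs
  imports Complex_Main "HOL-Library.Nat_Bijection" "HOL-Algebra.Group"
begin

definition nat_add_monoid :: "nat monoid" where
  "nat_add_monoid = \<lparr>carrier = UNIV, mult = (+), one = 0\<rparr>"

definition generated_submonoid :: "nat set \<Rightarrow> nat set" where
  "generated_submonoid A = (\<lambda>M. submonoid M nat_add_monoid) hull A"

definition numerical_semigroup :: "nat set \<Rightarrow> bool" where
  "numerical_semigroup S \<longleftrightarrow> submonoid S nat_add_monoid \<and> finite (UNIV - S)"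

text \<open>The maximum is taken over all integers, not only over the gaps of \<open>S\<close> in the natural
  numbers; this is what gives the value \<open>-1\<close> for \<open>S = UNIV\<close>. It is only meaningful when the
  complement of \<open>S\<close> is finite.\<close>
definition frobenius_number :: "nat set \<Rightarrow> int" where
  "frobenius_number S = (GREATEST z::int. z \<notin> int ` S)"

lemma frobenius_number_UNIV: "frobenius_number UNIV = -1"
  unfolding frobenius_number_def
proof (rule Greatest_equality)
  show "- 1 \<notin> range int"
    by auto
next
  fix z :: int
  assume "z \<notin> range int"
  then have "\<not> 0 \<le> z"
    by (metis nonneg_int_cases rangeI)
  then show "z \<le> - 1"
    by simp
qed

text \<open>Division by two is exact here: if \<open>n + i\<close> is odd, then \<open>n + i mod 2 + 1\<close> is even.\<close>
definition generator :: "nat \<Rightarrow> nat \<Rightarrow> nat" where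
  "generator n i = (n + i) * (n + i mod 2 + 1) div 2"

lemma generator_exact: "2 * generator n i = (n + i) * (n + i mod 2 + 1)"
proof -
  have "even ((n + i) * (n + i mod 2 + 1))"
    by (cases "even i") (auto simp: mod2_eq_if)
  then show ?thesis
    unfolding generator_def by simp
qed

end

theory Submission
  imports Defs
begin

text \<open>Each generator of even index is a fixed multiple of a term of one arithmetic progression, and
  each generator of odd index a fixed multiple of a term of a second one, the two factors being
  coprime. Each factor lies in the semigroup generated by the other progression, so \<open>S\<close> is a gluing
  \<open>c X + c' Y\<close>, for which \<open>F(S) = c F(X) + c' F(Y) + c c'\<close>. The Frobenius number of
  \<open>\<langle>a, a + d, \<dots>, a + k d\<rangle>\<close> is read off the unique representation \<open>z = s a + t d\<close> with
  \<open>0 \<le> t < a\<close>: membership means \<open>t \<le> k s\<close>.\<close>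

section \<open>Frobenius numbers and submonoids of the natural numbers\<close>

text \<open>A relational form of the Frobenius number that presupposes no greatest element. The
  value is an integer, so negative values such as -1 need no separate treatment.\<close>

definition is_frobenius :: "nat set \<Rightarrow> int \<Rightarrow> bool" where
  "is_frobenius X f \<longleftrightarrow> f \<notin> int ` X \<and> (\<forall>z>f. z \<in> int ` X)"

lemma is_frobenius_frobenius_number:
  assumes "is_frobenius X f"
  shows "frobenius_number X = f"
  unfolding frobenius_number_def
  using assms unfolding is_frobenius_def
  by (intro Greatest_equality) (auto simp: not_less[symmetric])

lemma is_frobenius_finite:
  assumes "is_frobenius X f"
  shows "finite (UNIV - X)"
proof (rule finite_subset)
  show "UNIV - X \<subseteq> {..nat f}"
  proof
    fix x assume "x \<in> UNIV - X"
    then have "int x \<notin> int ` X" by auto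
    then have "int x \<le> f"
      using assms unfolding is_frobenius_def by (meson not_less)
    then show "x \<in> {..nat f}" by auto
  qed
qed simp

lemma submonoid_nat_add_iff:
  "submonoid M nat_add_monoid \<longleftrightarrow> 0 \<in> M \<and> (\<forall>x\<in>M. \<forall>y\<in>M. x + y \<in> M)"
  by (auto simp: submonoid_def nat_add_monoid_def)

lemma submonoid_mult_mem:
  assumes "submonoid M nat_add_monoid" "x \<in> M"
  shows "j * x \<in> M"
  using assms by (induction j) (auto simp: submonoid_nat_add_iff)

subsection \<open>Semigroups generated by arithmetic progressions\<close>

text \<open>Explicit form of the semigroup generated by \<open>a + j * d\<close> for
  \<open>j \<le> k\<close>: \<open>s\<close> counts the summands and \<open>t\<close> is the sum of
  their indices \<open>j\<close>, which takes every value from 0 to \<open>k * s\<close>.\<close>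

definition progression_semigroup :: "nat \<Rightarrow> nat \<Rightarrow> nat \<Rightarrow> nat set" where
  "progression_semigroup a d k = {s * a + t * d | s t. t \<le> k * s}"

lemma progression_semigroup_submonoid:
  "submonoid (progression_semigroup a d k) nat_add_monoid"
  unfolding submonoid_nat_add_iff
proof (intro conjI ballI)
  show "0 \<in> progression_semigroup a d k"
    unfolding progression_semigroup_def by force
next
  fix x y assume "x \<in> progression_semigroup a d k" "y \<in> progression_semigroup a d k"
  then obtain s t s' t' where "x = s * a + t * d" "t \<le> k * s" "y = s' * a + t' * d" "t' \<le> k * s'"
    unfolding progression_semigroup_def by blast
  then have "x + y = (s + s') * a + (t + t') * d" "t + t' \<le> k * (s + s')"
    by (auto simp: algebra_simps)
  then show "x + y \<in> progression_semigroup a d k"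
    unfolding progression_semigroup_def by blast
qed

lemma progression_term_mem:
  assumes "j \<le> k"
  shows "a + j * d \<in> progression_semigroup a d k"
  using assms unfolding progression_semigroup_def
  by (intro CollectI exI[of _ 1] exI[of _ j]) auto

text \<open>Minimality of the explicit form: \<open>s * a + t * d\<close> splits into
  \<open>s\<close> progression terms, removed one at a time by induction on
  \<open>s\<close>.\<close>

lemma scaled_progression_mem:
  assumes M: "submonoid M nat_add_monoid"
    and gen: "\<And>j. j \<le> k \<Longrightarrow> c * (a + j * d) \<in> M"
    and x: "x \<in> progression_semigroup a d k"
  shows "c * x \<in> M"
proof -
  have "c * (s * a + t * d) \<in> M" if "t \<le> k * s" for s t
    using that
  proof (induction s arbitrary: t)
    case 0
    then show ?case using M by (simp add: submonoid_nat_add_iff)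
  next
    case (Suc s)
    \<comment> \<open>Greedy choice: taking the largest admissible index leaves
      \<open>t - k \<le> k * s\<close> or 0 for the remaining \<open>s\<close> summands.\<close>
    define j where "j = min t k"
    have t: "t = j + (t - j)" and "j \<le> k" "t - j \<le> k * s"
      using Suc.prems by (auto simp: j_def)
    then have "c * (a + j * d) + c * (s * a + (t - j) * d) \<in> M"
      using M gen Suc.IH by (auto simp: submonoid_nat_add_iff)
    also have "c * (a + j * d) + c * (s * a + (t - j) * d) = c * (Suc s * a + (j + (t - j)) * d)"
      by (simp add: algebra_simps)
    finally show ?case using t by simp
  qed
  then show ?thesis using x unfolding progression_semigroup_def by blast
qed

text \<open>The two bounds say that \<open>c\<close> is the ceiling of \<open>(a - 1) / k\<close>.
  The claimed value equals \<open>(c - 1) * a + (a - 1) * d\<close>: the largest residue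
  \<open>t = a - 1\<close> with the largest \<open>s\<close> for which \<open>t \<le> k * s\<close>
  fails.\<close>

lemma progression_semigroup_frobenius:
  fixes a d k :: nat and c :: int
  assumes a: "a \<ge> 1" and k: "k \<ge> 1" and co: "coprime a d"
    and lo: "int k * (c - 1) < int a - 1" and hi: "int a - 1 \<le> int k * c"
  shows "is_frobenius (progression_semigroup a d k) (c * int a + (int d - 1) * int a - int d)"
  unfolding is_frobenius_def
proof (intro conjI allI impI notI)
  let ?f = "c * int a + (int d - 1) * int a - int d"
  assume "?f \<in> int ` progression_semigroup a d k"
  then obtain s t where eq: "?f = int s * int a + int t * int d" and t: "t \<le> k * s"
    unfolding progression_semigroup_def by auto
  \<comment> \<open>Any other representation of \<open>?f\<close> differs from
    \<open>(c - 1, a - 1)\<close> by a multiple of \<open>(-d, a)\<close>. As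
    \<open>t \<ge> 0\<close>, it can only have larger \<open>t\<close> and no larger
    \<open>s\<close>, so \<open>t \<le> k * s\<close> still fails.\<close>
  have "int a * (c + int d - 1 - int s) = int d * (int t + 1)"
    using eq by (simp add: algebra_simps)
  then have "int a dvd int d * (int t + 1)" by (metis dvd_triv_left)
  then have "int a dvd int t + 1"
    using co by (simp add: coprime_dvd_mult_right_iff)
  then obtain j where j: "int t + 1 = int a * j" by (auto elim: dvdE)
  have "int a * (c + int d - 1 - int s) = int a * (int d * j)"
    using \<open>int a * (c + int d - 1 - int s) = int d * (int t + 1)\<close> j by (simp add: mult.left_commute)
  then have "c + int d - 1 - int s = int d * j" using a by simp
  moreover have "int a * j > 0" using j by linarith
  then have "j \<ge> 1" using a by (simp add: zero_less_mult_iff)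
  then have "int d * 1 \<le> int d * j" by (intro mult_left_mono) auto
  ultimately have "int s \<le> c - 1" by linarith
  then have "int k * int s \<le> int k * (c - 1)" by (intro mult_left_mono) auto
  moreover have "int a * 1 \<le> int a * j" using \<open>j \<ge> 1\<close> by (intro mult_left_mono) auto
  moreover have "int t \<le> int k * int s" using t by (metis of_nat_le_iff of_nat_mult)
  ultimately show False using j lo by linarith
next
  fix z :: int
  assume z: "z > c * int a + (int d - 1) * int a - int d"
  obtain u v :: int where uv: "u * int a + v * int d = 1"
    using co bezout_int[of "int a" "int d"] by auto
  \<comment> \<open>The Bezout coefficient of \<open>d\<close> is reduced modulo \<open>a\<close>;
    \<open>s\<close> absorbs the quotient.\<close>
  define t where "t = (z * v) mod int a"
  have t: "0 \<le> t" "t \<le> int a - 1" using a by (auto simp: t_def)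
  define s where "s = z * u + int d * ((z * v) div int a)"
  have t_eq: "t = z * v - int a * ((z * v) div int a)"
    unfolding t_def by (simp add: minus_mult_div_eq_mod)
  have "s * int a + t * int d = z * (u * int a + v * int d)"
    unfolding s_def t_eq by (simp add: algebra_simps)
  then have eq: "z = s * int a + t * int d" using uv by simp
  \<comment> \<open>Since \<open>z\<close> exceeds \<open>(c - 1) * a + (a - 1) * d\<close>, the
    bound on \<open>t\<close> forces \<open>s > c - 1\<close>.\<close>
  have "t * int d \<le> (int a - 1) * int d" using t by (intro mult_right_mono) auto
  then have "(c - 1) * int a < s * int a" using eq z by (simp add: algebra_simps)
  then have "c \<le> s" using a by simp
  then have "int k * c \<le> int k * s" by (intro mult_left_mono) auto
  then have ts: "t \<le> int k * s" using t hi by linarith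
  then have "int k * s \<ge> 0" using t by linarith
  then have "s \<ge> 0" using k by (simp add: zero_le_mult_iff)
  have "int (nat s * a + nat t * d) = z" using eq t \<open>s \<ge> 0\<close> by simp
  moreover have "int (nat t) \<le> int (k * nat s)" using ts t \<open>s \<ge> 0\<close> by simp
  then have "nat t \<le> k * nat s" by (simp only: of_nat_le_iff)
  ultimately show "z \<in> int ` progression_semigroup a d k"
    unfolding progression_semigroup_def by blast
qed

subsection \<open>Gluings\<close>

text \<open>The conditions usually attached to a gluing (\<open>a\<close> and \<open>b\<close>
  coprime, \<open>a \<in> Y\<close>, \<open>b \<in> X\<close>) are left to
  \<open>gluing_frobenius\<close>.\<close>

definition gluing :: "nat \<Rightarrow> nat set \<Rightarrow> nat \<Rightarrow> nat set \<Rightarrow> nat set" where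
  "gluing a X b Y = {a * x + b * y | x y. x \<in> X \<and> y \<in> Y}"

lemma gluing_submonoid:
  assumes "submonoid X nat_add_monoid" "submonoid Y nat_add_monoid"
  shows "submonoid (gluing a X b Y) nat_add_monoid"
  unfolding submonoid_nat_add_iff
proof (intro conjI ballI)
  show "0 \<in> gluing a X b Y"
    using assms unfolding submonoid_nat_add_iff gluing_def by force
next
  fix z z' assume "z \<in> gluing a X b Y" "z' \<in> gluing a X b Y"
  then obtain x y x' y' where "z = a * x + b * y" "z' = a * x' + b * y'"
    and mem: "x \<in> X" "y \<in> Y" "x' \<in> X" "y' \<in> Y"
    unfolding gluing_def by blast
  then have "z + z' = a * (x + x') + b * (y + y')" by (simp add: algebra_simps)
  then show "z + z' \<in> gluing a X b Y"
    using assms mem unfolding submonoid_nat_add_iff gluing_def by blast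
qed

text \<open>Integer solutions of \<open>z = a * x + b * y\<close> differ by multiples of
  \<open>(b, -a)\<close>, and adding \<open>b\<close> preserves \<open>X\<close> while adding
  \<open>a\<close> preserves \<open>Y\<close>. The extremal value comes from the pair
  \<open>x = f\<close>, \<open>y = g + a\<close>.\<close>

lemma gluing_frobenius:
  assumes X: "submonoid X nat_add_monoid" and Y: "submonoid Y nat_add_monoid"
    and pos: "a \<ge> 1" "b \<ge> 1" and co: "coprime a b" and mem: "a \<in> Y" "b \<in> X"
    and F: "is_frobenius X f" "is_frobenius Y g"
  shows "is_frobenius (gluing a X b Y) (int a * f + int b * g + int a * int b)"
  unfolding is_frobenius_def
proof (intro conjI allI impI notI)
  have shift: "int (z + j * w) \<in> int ` M"
    if "submonoid M nat_add_monoid" "z \<in> M" "w \<in> M" for M z w j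
    using that submonoid_mult_mem[of M w j]
    by (intro imageI) (simp add: submonoid_nat_add_iff)
  assume "int a * f + int b * g + int a * int b \<in> int ` gluing a X b Y"
  then obtain x y where xy: "x \<in> X" "y \<in> Y"
    and eq: "int a * f + int b * g + int a * int b = int a * int x + int b * int y"
    unfolding gluing_def by auto
  have "int a * (f + int b - int x) = int b * (int y - g)"
    using eq by (simp add: algebra_simps)
  then have "int a dvd int b * (int y - g)" by (metis dvd_triv_left)
  then have "int a dvd int y - g" using co by (simp add: coprime_dvd_mult_right_iff)
  then obtain j where j: "int y - g = int a * j" by (auto elim: dvdE)
  then have "int a * (f + int b - int x) = int a * (int b * j)"
    using \<open>int a * (f + int b - int x) = int b * (int y - g)\<close> by simp
  then have "f + int b - int x = int b * j" using pos by simp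
  \<comment> \<open>Also \<open>g = y - a * j\<close>. So \<open>j \<ge> 1\<close> would put
    \<open>f\<close> into \<open>X\<close>, and \<open>j \<le> 0\<close> would put \<open>g\<close>
    into \<open>Y\<close>.\<close>
  then have j': "f = int x + int b * (j - 1)" by (simp add: algebra_simps)
  show False
  proof (cases "j \<ge> 1")
    case True
    then have "f = int (x + nat (j - 1) * b)" using j' by simp
    then show False
      using shift[OF X xy(1) mem(2)] F(1) unfolding is_frobenius_def by metis
  next
    case False
    then have "g = int (y + nat (- j) * a)" using j by (simp add: algebra_simps)
    then show False
      using shift[OF Y xy(2) mem(1)] F(2) unfolding is_frobenius_def by metis
  qed
next
  fix z assume z: "z > int a * f + int b * g + int a * int b"
  obtain u v :: int where uv: "u * int a + v * int b = 1"
    using co bezout_int[of "int a" "int b"] by auto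
  \<comment> \<open>The offset places \<open>y\<close>, congruent to \<open>z * v\<close> modulo
    \<open>a\<close>, in the window from \<open>g + 1\<close> to \<open>g + a\<close>. Then
    \<open>y\<close> lies in \<open>Y\<close>, and its upper bound forces
    \<open>f < x\<close>.\<close>
  define w where "w = z * v - g - 1"
  define y where "y = g + 1 + w mod int a"
  define x where "x = z * u + int b * (w div int a)"
  have w: "w mod int a = w - int a * (w div int a)" by (simp add: minus_mult_div_eq_mod)
  have "int a * x + int b * y = z * u * int a + int b * (g + 1 + w)"
    unfolding x_def y_def w by (simp add: algebra_simps)
  also have "\<dots> = z * (u * int a + v * int b)"
    unfolding w_def by (simp add: algebra_simps)
  finally have eq: "z = int a * x + int b * y" using uv by simp
  have "w mod int a \<ge> 0" "w mod int a < int a" using pos by auto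
  then have y: "g < y" "y \<le> g + int a" unfolding y_def by linarith+
  have "int b * y \<le> int b * (g + int a)" using y by (intro mult_left_mono) auto
  then have "int a * f < int a * x" using z eq by (simp add: algebra_simps)
  then have "f < x" using pos by simp
  then obtain x' y' where "x' \<in> X" "y' \<in> Y" "x = int x'" "y = int y'"
    using F y(1) unfolding is_frobenius_def by blast
  then show "z \<in> int ` gluing a X b Y"
    using eq unfolding gluing_def by (intro image_eqI[of _ _ "a * x' + b * y'"]) auto
qed

lemma generated_submonoid_two_progressions:
  assumes "A = {c * (a + j * d) | j. j \<le> p} \<union> {c' * (a' + j * d') | j. j \<le> q}"
  shows "generated_submonoid A
    = gluing c (progression_semigroup a d p) c' (progression_semigroup a' d' q)"
    (is "_ = gluing c ?X c' ?Y")
  unfolding generated_submonoid_def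
proof (rule hull_unique)
  have 0: "0 \<in> ?X" "0 \<in> ?Y"
    using progression_semigroup_submonoid submonoid_nat_add_iff by blast+
  show "A \<subseteq> gluing c ?X c' ?Y"
  proof
    fix z assume "z \<in> A"
    then consider j where "j \<le> p" "z = c * (a + j * d) + c' * 0"
      | j where "j \<le> q" "z = c * 0 + c' * (a' + j * d')"
      using assms by auto
    then show "z \<in> gluing c ?X c' ?Y"
      using 0 progression_term_mem unfolding gluing_def by cases blast+
  qed
  show "submonoid (gluing c ?X c' ?Y) nat_add_monoid"
    by (intro gluing_submonoid progression_semigroup_submonoid)
next
  fix M assume A: "A \<subseteq> M" and M: "submonoid M nat_add_monoid"
  have "c * x \<in> M" if "x \<in> ?X" for x
    using M _ that by (rule scaled_progression_mem) (use A assms in blast)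
  moreover have "c' * y \<in> M" if "y \<in> ?Y" for y
    using M _ that by (rule scaled_progression_mem) (use A assms in blast)
  ultimately show "gluing c ?X c' ?Y \<subseteq> M"
    using M unfolding gluing_def submonoid_nat_add_iff by blast
qed

text \<open>Combines the two Frobenius formulas. The memberships are crossed as gluing requires:
  each factor lies in the semigroup of the other progression.\<close>

lemma two_progressions_frobenius:
  assumes A: "A = {c * (a + j * d) | j. j \<le> p} \<union> {c' * (a' + j * d') | j. j \<le> q}"
    and pos: "c \<ge> 1" "c' \<ge> 1" "a \<ge> 1" "a' \<ge> 1" "p \<ge> 1" "q \<ge> 1"
    and co: "coprime c c'" "coprime a d" "coprime a' d'"
    and mem: "c \<in> progression_semigroup a' d' q" "c' \<in> progression_semigroup a d p"
    and e: "e = \<lceil>(real a - 1) / real p\<rceil>" and e': "e' = \<lceil>(real a' - 1) / real q\<rceil>"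
  shows "numerical_semigroup (generated_submonoid A) \<and>
    frobenius_number (generated_submonoid A) =
      int c * (e * int a + (int d - 1) * int a - int d)
      + int c' * (e' * int a' + (int d' - 1) * int a' - int d') + int c * int c'"
proof -
  \<comment> \<open>Turns the real ceiling into the integer inequalities expected by
    \<open>progression_semigroup_frobenius\<close>.\<close>
  have bounds: "int k * (\<lceil>(real b - 1) / real k\<rceil> - 1) < int b - 1"
    "int b - 1 \<le> int k * \<lceil>(real b - 1) / real k\<rceil>" if "k \<ge> 1" for k b :: nat
  proof -
    define m where "m = \<lceil>(real b - 1) / real k\<rceil>"
    have "real_of_int m - 1 < (real b - 1) / real k" "(real b - 1) / real k \<le> real_of_int m"
      unfolding m_def by linarith+
    then have "real k * (real_of_int m - 1) < real b - 1" "real b - 1 \<le> real k * real_of_int m"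
      using that by (auto simp: field_simps)
    then have "real_of_int (int k * (m - 1)) < real_of_int (int b - 1)"
      "real_of_int (int b - 1) \<le> real_of_int (int k * m)" by simp_all
    then show "int k * (\<lceil>(real b - 1) / real k\<rceil> - 1) < int b - 1"
      "int b - 1 \<le> int k * \<lceil>(real b - 1) / real k\<rceil>"
      unfolding m_def by (simp_all only: of_int_less_iff of_int_le_iff)
  qed
  let ?G = "gluing c (progression_semigroup a d p) c' (progression_semigroup a' d' q)"
  have "is_frobenius ?G (int c * (e * int a + (int d - 1) * int a - int d)
      + int c' * (e' * int a' + (int d' - 1) * int a' - int d') + int c * int c')"
    using pos co mem e e' bounds
    by (intro gluing_frobenius progression_semigroup_frobenius progression_semigroup_submonoid) auto
  moreover have "submonoid ?G nat_add_monoid"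
    by (intro gluing_submonoid progression_semigroup_submonoid)
  ultimately show ?thesis
    unfolding generated_submonoid_two_progressions[OF A] numerical_semigroup_def
    using is_frobenius_finite is_frobenius_frobenius_number by blast
qed

subsection \<open>The generators\<close>

text \<open>With \<open>k = 0\<close> the truncated \<open>(k - 1) div 2\<close> would be 0 and
  wrongly admit index 1, hence \<open>k \<ge> 1\<close>.\<close>

lemma generators_by_parity:
  assumes "k \<ge> 1"
  shows "{generator n i | i. 0 \<le> i \<and> i \<le> k}
    = {generator n (2 * j) | j. j \<le> k div 2} \<union> {generator n (2 * j + 1) | j. j \<le> (k - 1) div 2}"
    (is "?L = ?R")
proof
  show "?L \<subseteq> ?R"
  proof
    fix x assume "x \<in> ?L"
    then obtain i where i: "x = generator n i" "i \<le> k" by blast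
    show "x \<in> ?R"
    proof (cases "even i")
      case True
      then obtain j where "i = 2 * j" by (elim evenE)
      moreover from this i have "j \<le> k div 2" by linarith
      ultimately show ?thesis using i by blast
    next
      case False
      then obtain j where "i = 2 * j + 1" by (elim oddE)
      moreover from this i have "j \<le> (k - 1) div 2" by linarith
      ultimately show ?thesis using i by blast
    qed
  qed
  have "2 * j \<le> k" if "j \<le> k div 2" for j using that by linarith
  moreover have "2 * j + 1 \<le> k" if "j \<le> (k - 1) div 2" for j using that assms by linarith
  ultimately show "?R \<subseteq> ?L" by blast
qed

text \<open>In these four names the first parity is that of \<open>n\<close>, the second that of the
  index. The factor \<open>j * 1\<close> keeps the shape \<open>c * (a + j * d)\<close>.\<close>

lemma generator_even_index_even: "generator (2 * m) (2 * j) = (2 * m + 1) * (m + j * 1)"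
  using generator_exact[of "2 * m" "2 * j"] by (simp add: algebra_simps)

lemma generator_even_index_odd:
  "generator (2 * m) (2 * j + 1) = (m + 1) * (2 * m + 1 + j * 2)"
proof -
  have "(2 * j + 1) mod 2 = 1" by simp
  then have "2 * generator (2 * m) (2 * j + 1) = (2 * m + (2 * j + 1)) * (2 * m + 1 + 1)"
    by (simp only: generator_exact)
  then show ?thesis by (simp add: algebra_simps)
qed

lemma generator_odd_index_even:
  "generator (2 * m + 1) (2 * j) = (m + 1) * (2 * m + 1 + j * 2)"
  using generator_exact[of "2 * m + 1" "2 * j"] by (simp add: algebra_simps)

lemma generator_odd_index_odd:
  "generator (2 * m + 1) (2 * j + 1) = (2 * m + 3) * (m + 1 + j * 1)"
proof -
  have "(2 * j + 1) mod 2 = 1" by simp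
  then have "2 * generator (2 * m + 1) (2 * j + 1) = (2 * m + 1 + (2 * j + 1)) * (2 * m + 1 + 1 + 1)"
    by (simp only: generator_exact)
  then show ?thesis by (simp add: algebra_simps)
qed

theorem theorem1p3:
  fixes n k :: nat and S :: "nat set"
  assumes "n \<ge> 1" and "k \<ge> 3"
    and "S = generated_submonoid {generator n i | i. 0 \<le> i \<and> i \<le> k}"
  shows "numerical_semigroup S \<and>
    frobenius_number S =
      (if even n then
         \<lceil>(real n - 2) / (2 * real (k div 2))\<rceil> * int (triangle n)
         + \<lceil>real n / real ((k - 1) div 2)\<rceil> * int (triangle (n + 1))
         + (int n)\<^sup>2 + int n - 1
       else
         \<lceil>(real n - 1) / real (k div 2)\<rceil> * int (triangle n)
         + \<lceil>(real n - 1) / (2 * real ((k - 1) div 2))\<rceil> * int (triangle (n + 1))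
         + (int n)\<^sup>2 - 2)"
proof -
  define p q where "p = k div 2" and "q = (k - 1) div 2"
  have pq: "p \<ge> 1" "q \<ge> 1" using assms(2) by (auto simp: p_def q_def)
  have gens: "{generator n i | i. 0 \<le> i \<and> i \<le> k}
    = {generator n (2 * j) | j. j \<le> p} \<union> {generator n (2 * j + 1) | j. j \<le> q}"
    unfolding p_def q_def using assms(2) by (intro generators_by_parity) simp
  \<comment> \<open>The progression starting at about \<open>n / 2\<close> yields a fraction that
    must be doubled above and below to match the stated ceiling.\<close>
  have half: "(2 * x) / (2 * y) = x / y" for x y :: real by simp
  show ?thesis
  proof (cases "even n")
    case True
    then obtain m where n: "n = 2 * m" by (elim evenE)
    with assms(1) have m: "m \<ge> 1" by simp
    define e e' where "e = \<lceil>(real m - 1) / real p\<rceil>"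
      and "e' = \<lceil>(real (2 * m + 1) - 1) / real q\<rceil>"
    have co: "coprime (2 * m + 1) (m + 1)"
    proof (rule coprimeI)
      fix l assume l: "l dvd 2 * m + 1" "l dvd m + 1"
      have "l dvd 2 * (m + 1)" using l(2) by (rule dvd_mult)
      then have "l dvd (2 * m + 1) + 1" by simp
      then show "is_unit l" using l(1) by (simp only: dvd_add_right_iff)
    qed
    have "numerical_semigroup S \<and> frobenius_number S =
      int (2 * m + 1) * (e * int m + (int 1 - 1) * int m - int 1)
      + int (m + 1) * (e' * int (2 * m + 1) + (int 2 - 1) * int (2 * m + 1) - int 2)
      + int (2 * m + 1) * int (m + 1)"
      unfolding assms(3)
    proof (rule two_progressions_frobenius[OF _ _ _ _ _ pq _ _ _ _ _ e_def e'_def])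
      show "{generator n i | i. 0 \<le> i \<and> i \<le> k} = {(2 * m + 1) * (m + j * 1) | j. j \<le> p}
        \<union> {(m + 1) * (2 * m + 1 + j * 2) | j. j \<le> q}"
        using gens unfolding n generator_even_index_even generator_even_index_odd .
      \<comment> \<open>One factor is the first term of the other progression; the factor
        \<open>m + 1\<close> is the second term of \<open>m, m + 1, ...\<close>, available because
        \<open>p \<ge> 1\<close>.\<close>
      show "2 * m + 1 \<in> progression_semigroup (2 * m + 1) 2 q"
        using progression_term_mem[of 0 q "2 * m + 1" 2] by simp
      show "m + 1 \<in> progression_semigroup m 1 p"
        using progression_term_mem[of 1 p m 1] pq by simp
    qed (use m co in auto)
    moreover have "e = \<lceil>(real n - 2) / (2 * real p)\<rceil>"
      unfolding e_def n using half[of "real m - 1" "real p"] by (simp add: algebra_simps)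
    moreover have "e' = \<lceil>real n / real q\<rceil>" unfolding e'_def n by simp
    \<comment> \<open>Both triangular numbers are a factor times the first term of its progression,
      so they are exactly the coefficients of \<open>e\<close> and \<open>e'\<close>.\<close>
    moreover have "int (triangle n) = int m * (2 * int m + 1)"
      "int (triangle (n + 1)) = (int m + 1) * (2 * int m + 1)"
      unfolding n triangle_def by (simp_all add: algebra_simps)
    ultimately show ?thesis
      using True unfolding p_def[symmetric] q_def[symmetric]
      by (simp add: n algebra_simps power2_eq_square)
  next
    case False
    then obtain m where n: "n = 2 * m + 1" by (elim oddE)
    define e e' where "e = \<lceil>(real (2 * m + 1) - 1) / real p\<rceil>"
      and "e' = \<lceil>(real (m + 1) - 1) / real q\<rceil>"
    have co: "coprime (m + 1) (2 * m + 3)"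
    proof (rule coprimeI)
      fix l assume l: "l dvd m + 1" "l dvd 2 * m + 3"
      have "l dvd 2 * (m + 1) + 1" using l(2) by (simp add: numeral_3_eq_3)
      moreover have "l dvd 2 * (m + 1)" using l(1) by (rule dvd_mult)
      ultimately show "is_unit l" by (simp only: dvd_add_right_iff)
    qed
    have "numerical_semigroup S \<and> frobenius_number S =
      int (m + 1) * (e * int (2 * m + 1) + (int 2 - 1) * int (2 * m + 1) - int 2)
      + int (2 * m + 3) * (e' * int (m + 1) + (int 1 - 1) * int (m + 1) - int 1)
      + int (m + 1) * int (2 * m + 3)"
      unfolding assms(3)
    proof (rule two_progressions_frobenius[OF _ _ _ _ _ pq _ _ _ _ _ e_def e'_def])
      show "{generator n i | i. 0 \<le> i \<and> i \<le> k} = {(m + 1) * (2 * m + 1 + j * 2) | j. j \<le> p}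
        \<union> {(2 * m + 3) * (m + 1 + j * 1) | j. j \<le> q}"
        using gens unfolding n generator_odd_index_even generator_odd_index_odd .
      \<comment> \<open>Again a first term, and \<open>2 * m + 3\<close> is the second term of the
        progression with difference 2.\<close>
      show "m + 1 \<in> progression_semigroup (m + 1) 1 q"
        using progression_term_mem[of 0 q "m + 1" 1] by simp
      show "2 * m + 3 \<in> progression_semigroup (2 * m + 1) 2 p"
        using progression_term_mem[of 1 p "2 * m + 1" 2] pq by (simp add: numeral_3_eq_3)
    qed (use co in auto)
    moreover have "e = \<lceil>(real n - 1) / real p\<rceil>" unfolding e_def n by simp
    moreover have "e' = \<lceil>(real n - 1) / (2 * real q)\<rceil>"
      unfolding e'_def n using half[of "real m" "real q"] by simp
    moreover have "int (triangle n) = (int m + 1) * (2 * int m + 1)"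
      "int (triangle (n + 1)) = (int m + 1) * (2 * int m + 3)"
      unfolding n triangle_def by (simp_all add: algebra_simps)
    ultimately show ?thesis
      using False unfolding p_def[symmetric] q_def[symmetric]
      by (simp add: n algebra_simps power2_eq_square)
  qed
qed

end
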